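(* Let $X$ be a $\sigma$-Dedekind complete Banach lattice and let $\varepsilon\ge 0$. If $T\in B(X)$ is invertible and $\varepsilon$-band preserving, then $T^{-1}$ is $(2\|T^{-1}\|^2\varepsilon)$-band preserving.
   Context: $B(X)$ denotes the space of bounded linear operators on $X$. For $\delta\ge 0$, a linear map $T:X\to X$ on a Banach lattice is $\delta$-band preserving ($\delta$-BP) if for every $x\in X$, $\sup\{\||Tx|\wedge y\| : y\ge 0,\ y\perp x\}\le\delta\|x\|$. $X$ is $\sigma$-Dedekind complete if every order bounded sequence has a supremum and an infimum. *)

theory Defs
  imports "HOL-Analysis.Analysis" "HOL-Library.Lattice_Algebras"
begin

class banach_lattice = banach + ordered_real_vector + lattice_ab_group_add_abs +
  assumes norm_lattice_mono: "\<bar>x\<bar> \<le> \<bar>y\<bar> \<Longrightarrow> norm x \<le> norm y"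

class sigma_dedekind_complete_banach_lattice = banach_lattice +
  assumes order_bounded_seq_has_sup:
    "\<lbrakk>bdd_below (range u); bdd_above (range u)\<rbrakk>
      \<Longrightarrow> \<exists>s. (\<forall>n::nat. u n \<le> s) \<and> (\<forall>z. (\<forall>n. u n \<le> z) \<longrightarrow> s \<le> z)"
  and order_bounded_seq_has_inf:
    "\<lbrakk>bdd_below (range u); bdd_above (range u)\<rbrakk>
      \<Longrightarrow> \<exists>i. (\<forall>n::nat. i \<le> u n) \<and> (\<forall>z. (\<forall>n. z \<le> u n) \<longrightarrow> z \<le> i)"

instance real :: banach_lattice
  by standard simp

instance real :: sigma_dedekind_complete_banach_lattice
proof
  fix u :: "nat \<Rightarrow> real"
  assume b: "bdd_below (range u)" and a: "bdd_above (range u)"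
  show "\<exists>s. (\<forall>n. u n \<le> s) \<and> (\<forall>z. (\<forall>n. u n \<le> z) \<longrightarrow> s \<le> z)"
    by (rule exI[of _ "Sup (range u)"]) (auto intro!: cSup_upper cSup_least a)
  show "\<exists>i. (\<forall>n. i \<le> u n) \<and> (\<forall>z. (\<forall>n. z \<le> u n) \<longrightarrow> z \<le> i)"
    by (rule exI[of _ "Inf (range u)"]) (auto intro!: cInf_lower cInf_greatest b)
qed

definition lattice_disjoint :: "'a::banach_lattice \<Rightarrow> 'a \<Rightarrow> bool"  (infix "\<bottom>\<^sub>l" 50)
  where "x \<bottom>\<^sub>l y \<longleftrightarrow> inf \<bar>x\<bar> \<bar>y\<bar> = 0"

definition band_preserving :: "real \<Rightarrow> ('a::banach_lattice \<Rightarrow> 'a) \<Rightarrow> bool"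
  where "band_preserving \<delta> T \<longleftrightarrow> linear T \<and>
    (\<forall>x. Sup {norm (inf \<bar>T x\<bar> y) | y. 0 \<le> y \<and> y \<bottom>\<^sub>l x} \<le> \<delta> * norm x)"

text \<open>The real-valued supremum above is a genuine one: the set is nonempty and bounded.\<close>

lemma band_preserving_set:
  fixes T :: "'a::banach_lattice \<Rightarrow> 'a"
  shows "{norm (inf \<bar>T x\<bar> y) | y. 0 \<le> y \<and> y \<bottom>\<^sub>l x} \<noteq> {}"
    and "bdd_above {norm (inf \<bar>T x\<bar> y) | y. 0 \<le> y \<and> y \<bottom>\<^sub>l x}"
proof -
  have "(0::'a) \<bottom>\<^sub>l x"
    by (simp add: lattice_disjoint_def inf_absorb1)
  then show "{norm (inf \<bar>T x\<bar> y) | y. 0 \<le> y \<and> y \<bottom>\<^sub>l x} \<noteq> {}"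
    by blast
  have "norm (inf \<bar>T x\<bar> y) \<le> norm (T x)" if "0 \<le> y" for y
  proof (rule norm_lattice_mono)
    have "0 \<le> inf \<bar>T x\<bar> y" using that by simp
    then show "\<bar>inf \<bar>T x\<bar> y\<bar> \<le> \<bar>T x\<bar>" by (simp add: abs_of_nonneg)
  qed
  then show "bdd_above {norm (inf \<bar>T x\<bar> y) | y. 0 \<le> y \<and> y \<bottom>\<^sub>l x}"
    by (auto intro!: bdd_aboveI[where M = "norm (T x)"])
qed

definition invertible_blinfun :: "('a::real_normed_vector \<Rightarrow>\<^sub>L 'a) \<Rightarrow> bool"
  where "invertible_blinfun T \<longleftrightarrow> (\<exists>S. S o\<^sub>L T = id_blinfun \<and> T o\<^sub>L S = id_blinfun)"

definition inv_blinfun :: "('a::real_normed_vector \<Rightarrow>\<^sub>L 'a) \<Rightarrow> ('a \<Rightarrow>\<^sub>L 'a)"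
  where "inv_blinfun T = (THE S. S o\<^sub>L T = id_blinfun \<and> T o\<^sub>L S = id_blinfun)"

lemma inv_blinfun_eqI:
  assumes "S o\<^sub>L T = id_blinfun" "T o\<^sub>L S = id_blinfun"
  shows "inv_blinfun T = S"
  unfolding inv_blinfun_def
proof (rule the_equality)
  fix R assume R: "R o\<^sub>L T = id_blinfun \<and> T o\<^sub>L R = id_blinfun"
  show "R = S"
  proof (rule blinfun_eqI)
    fix x
    have "R x = R (T (S x))"
      using arg_cong[OF assms(2), of "\<lambda>U. blinfun_apply U x"] by simp
    also have "\<dots> = S x"
      using arg_cong[OF conjunct1[OF R], of "\<lambda>U. blinfun_apply U (S x)"] by simp
    finally show "R x = S x" .
  qed
qed (use assms in auto)

end

theory Submission
  imports Defs
begin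

text \<open>
  Let \<open>S\<close> be the inverse of \<open>T\<close>, let \<open>y \<ge> 0\<close> be disjoint from \<open>x\<close>, put \<open>z = S x\<close>, and let \<open>P\<close> be
  the projection onto the band generated by \<open>y\<close>; it exists by \<open>\<sigma>\<close>-Dedekind completeness. Testing the
  hypothesis on \<open>T\<close> against \<open>\<bar>P T (z - P z)\<bar>\<close> and \<open>\<bar>T P z - P T P z\<bar>\<close> bounds the norms of both by
  \<open>\<epsilon> \<parallel>z\<parallel>\<close>. Since \<open>P T z = P x = 0\<close>, the elements \<open>P T P z\<close> and \<open>P T (z - P z)\<close> are opposite, so
  \<open>\<parallel>T P z\<parallel> \<le> 2 \<epsilon> \<parallel>z\<parallel>\<close>. Applying \<open>S\<close> bounds \<open>\<parallel>P z\<parallel>\<close>, and \<open>\<bar>z\<bar> \<and> y \<le> \<bar>P z\<bar>\<close>.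
\<close>

text \<open>Distributing \<open>+\<close> over \<open>inf\<close> turns the right side into the
  infimum of \<open>a + b\<close>, \<open>a + y\<close>, \<open>y + b\<close> and
  \<open>y + y\<close>, each of which dominates the left side.\<close>

lemma inf_add_le_add_inf:
  fixes a b y :: "'a::lattice_ab_group_add"
  assumes "0 \<le> a" "0 \<le> b" "0 \<le> y"
  shows "inf (a + b) y \<le> inf a y + inf b y"
proof -
  let ?t = "inf (a + b) y"
  have "?t \<le> a + b" by simp
  moreover have "?t \<le> a + y" "?t \<le> y + b" "?t \<le> y + y"
    using assms by (auto intro: le_infI2 add_increasing add_increasing2)
  ultimately show ?thesis
    by (simp add: add_inf_distrib_left add_inf_distrib_right)
qed

lemma lattice_disjoint_sym: "x \<bottom>\<^sub>l y \<longleftrightarrow> y \<bottom>\<^sub>l x"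
  by (simp add: lattice_disjoint_def inf_commute)

lemma lattice_disjointI:
  fixes x y :: "'a::banach_lattice"
  assumes "inf \<bar>x\<bar> \<bar>y\<bar> \<le> 0"
  shows "x \<bottom>\<^sub>l y"
  using assms by (simp add: lattice_disjoint_def order.antisym)

lemma lattice_disjoint_zero: "(0::'a::banach_lattice) \<bottom>\<^sub>l x"
  by (rule lattice_disjointI) simp

lemma lattice_disjoint_abs_left: "\<bar>x\<bar> \<bottom>\<^sub>l y \<longleftrightarrow> x \<bottom>\<^sub>l (y::'a::banach_lattice)"
  by (simp add: lattice_disjoint_def)

lemma lattice_disjoint_minus_left: "- x \<bottom>\<^sub>l y \<longleftrightarrow> x \<bottom>\<^sub>l (y::'a::banach_lattice)"
  by (simp add: lattice_disjoint_def)

lemma lattice_disjoint_add_left: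
  fixes a b y :: "'a::banach_lattice"
  assumes "a \<bottom>\<^sub>l y" "b \<bottom>\<^sub>l y"
  shows "(a + b) \<bottom>\<^sub>l y"
proof (rule lattice_disjointI)
  have "inf \<bar>a + b\<bar> \<bar>y\<bar> \<le> inf (\<bar>a\<bar> + \<bar>b\<bar>) \<bar>y\<bar>"
    by (intro inf_mono abs_triangle_ineq order_refl)
  also have "\<dots> \<le> inf \<bar>a\<bar> \<bar>y\<bar> + inf \<bar>b\<bar> \<bar>y\<bar>"
    by (intro inf_add_le_add_inf) auto
  finally show "inf \<bar>a + b\<bar> \<bar>y\<bar> \<le> 0"
    using assms by (simp add: lattice_disjoint_def)
qed

lemma lattice_disjoint_diff_left:
  fixes a b y :: "'a::banach_lattice"
  assumes "a \<bottom>\<^sub>l y" "b \<bottom>\<^sub>l y"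
  shows "(a - b) \<bottom>\<^sub>l y"
  using lattice_disjoint_add_left[of a y "- b"] assms by (simp add: lattice_disjoint_minus_left)

lemma lattice_disjoint_scaleR_nat_left:
  fixes v y :: "'a::banach_lattice"
  assumes "y \<bottom>\<^sub>l v"
  shows "(real n *\<^sub>R y) \<bottom>\<^sub>l v"
  by (induction n)
    (simp_all add: lattice_disjoint_zero scaleR_add_left lattice_disjoint_add_left assms)

text \<open>Meeting \<open>\<bar>b\<bar> \<le> \<bar>a + b\<bar> + \<bar>a\<bar>\<close> with
  \<open>\<bar>b\<bar>\<close> kills the term \<open>\<bar>a\<bar>\<close>. This makes band
  components no larger in norm than the whole element.\<close>

lemma lattice_disjoint_abs_le_abs_add:
  fixes a b :: "'a::banach_lattice"
  assumes "a \<bottom>\<^sub>l b"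
  shows "\<bar>b\<bar> \<le> \<bar>a + b\<bar>"
proof -
  have "\<bar>b\<bar> \<le> \<bar>a + b\<bar> + \<bar>a\<bar>"
    using abs_triangle_ineq4[of "a + b" a] by simp
  then have "\<bar>b\<bar> \<le> inf (\<bar>a + b\<bar> + \<bar>a\<bar>) \<bar>b\<bar>" by simp
  also have "\<dots> \<le> inf \<bar>a + b\<bar> \<bar>b\<bar> + inf \<bar>a\<bar> \<bar>b\<bar>"
    by (intro inf_add_le_add_inf) auto
  also have "\<dots> \<le> \<bar>a + b\<bar>"
    using assms by (simp add: lattice_disjoint_def)
  finally show ?thesis .
qed

text \<open>The band generated by \<open>y\<close>, described as the double disjoint complement of \<open>y\<close>.\<close>

definition in_band :: "'a::banach_lattice \<Rightarrow> 'a \<Rightarrow> bool"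
  where "in_band y a \<longleftrightarrow> (\<forall>v. v \<bottom>\<^sub>l y \<longrightarrow> a \<bottom>\<^sub>l v)"

lemma in_band_disjoint: "in_band y a \<Longrightarrow> b \<bottom>\<^sub>l y \<Longrightarrow> a \<bottom>\<^sub>l b"
  by (simp add: in_band_def)

lemma in_band_add: "in_band y a \<Longrightarrow> in_band y b \<Longrightarrow> in_band y (a + b)"
  by (simp add: in_band_def lattice_disjoint_add_left)

lemma in_band_diff: "in_band y a \<Longrightarrow> in_band y b \<Longrightarrow> in_band y (a - b)"
  by (simp add: in_band_def lattice_disjoint_diff_left)

text \<open>The band component is the supremum of the infima of \<open>w\<close> with the natural
  multiples of \<open>y\<close>. Only a countable supremum is taken, so sigma-Dedekind completeness
  suffices.\<close>

lemma band_decomposition_nonneg: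
  fixes w y :: "'a::sigma_dedekind_complete_banach_lattice"
  assumes w: "0 \<le> w" and y: "0 \<le> y"
  obtains a b where "w = a + b" "in_band y a" "b \<bottom>\<^sub>l y"
proof -
  define c where "c n = inf w (real n *\<^sub>R y)" for n
  have "bdd_below (range c)"
    unfolding c_def by (rule bdd_belowI[where m = 0]) (auto simp: w y scaleR_nonneg_nonneg)
  moreover have "bdd_above (range c)"
    unfolding c_def by (rule bdd_aboveI[where M = w]) auto
  ultimately obtain s where s: "\<And>n. c n \<le> s" and least: "\<And>z. (\<And>n. c n \<le> z) \<Longrightarrow> s \<le> z"
    using order_bounded_seq_has_sup[of c] by blast
  have "s \<le> w"
    by (rule least) (simp add: c_def)
  have "0 \<le> s"
    using s[of 0] w by (simp add: c_def inf_absorb2)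
  have "(w - s) \<bottom>\<^sub>l y"
  proof -
    let ?t = "inf (w - s) y"
    \<comment> \<open>\<open>?t\<close> lies below both \<open>w - s\<close> and \<open>y\<close>,
      so adding it to \<open>c n\<close> stays below \<open>w\<close> and below the next multiple of
      \<open>y\<close>. Hence \<open>s - ?t\<close> is again an upper bound, which forces
      \<open>?t \<le> 0\<close>.\<close>
    have "c n + ?t \<le> c (Suc n)" for n
    proof -
      have "c n + ?t \<le> s + (w - s)" by (intro add_mono s) simp
      moreover have "c n + ?t \<le> real n *\<^sub>R y + y" by (intro add_mono) (simp_all add: c_def)
      ultimately show ?thesis by (simp add: c_def[of "Suc n"] scaleR_add_left add.commute)
    qed
    then have "c n \<le> s - ?t" for n
      unfolding le_diff_eq by (rule order_trans[OF _ s[of "Suc n"]])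
    then have "s \<le> s - ?t" by (rule least)
    then have "?t \<le> 0" unfolding le_diff_eq by simp
    then show ?thesis
      using \<open>s \<le> w\<close> y by (intro lattice_disjointI) (simp add: abs_of_nonneg)
  qed
  moreover have "in_band y s"
    unfolding in_band_def
  proof (intro allI impI)
    fix v assume v: "v \<bottom>\<^sub>l y"
    define t where "t = inf s \<bar>v\<bar>"
    have t_bounds: "0 \<le> t" "t \<le> s" "t \<le> \<bar>v\<bar>"
      using \<open>0 \<le> s\<close> by (simp_all add: t_def)
    have "c n \<le> s - t" for n
    proof -
      have c0: "0 \<le> c n" by (simp add: c_def w y scaleR_nonneg_nonneg)
      have "inf \<bar>real n *\<^sub>R y\<bar> \<bar>v\<bar> = 0"
        using lattice_disjoint_scaleR_nat_left[of y v n] v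
        by (simp add: lattice_disjoint_def inf_commute)
      moreover have "\<bar>real n *\<^sub>R y\<bar> = real n *\<^sub>R y"
        by (simp add: abs_of_nonneg scaleR_nonneg_nonneg y)
      ultimately have d: "inf (real n *\<^sub>R y) \<bar>v\<bar> = 0" by simp
      have "inf t (c n) \<le> inf (real n *\<^sub>R y) \<bar>v\<bar>"
        by (auto simp: c_def intro: le_infI1 le_infI2 t_bounds)
      then have tc: "inf t (c n) \<le> 0" using d by simp
      \<comment> \<open>Since \<open>c n\<close> is disjoint from \<open>t\<close>, splitting
        \<open>s\<close> as \<open>(s - t) + t\<close> leaves \<open>c n\<close> below
        \<open>s - t\<close>. Leastness of \<open>s\<close> then gives
        \<open>t \<le> 0\<close>.\<close>
      have "c n \<le> inf ((s - t) + t) (c n)" using s by simp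
      also have "\<dots> \<le> inf (s - t) (c n) + inf t (c n)"
        using t_bounds c0 by (intro inf_add_le_add_inf) auto
      also have "\<dots> \<le> (s - t) + 0"
        by (intro add_mono tc) simp
      finally show ?thesis by simp
    qed
    then have "s \<le> s - t" by (rule least)
    then have "t \<le> 0" unfolding le_diff_eq by simp
    then show "s \<bottom>\<^sub>l v"
      using \<open>0 \<le> s\<close> by (intro lattice_disjointI) (simp add: abs_of_nonneg t_def)
  qed
  ultimately show thesis
    using that[of s "w - s"] by simp
qed

lemma band_decomposition:
  fixes w y :: "'a::sigma_dedekind_complete_banach_lattice"
  assumes y: "0 \<le> y"
  obtains a b where "w = a + b" "in_band y a" "b \<bottom>\<^sub>l y"
proof -
  obtain a b where ab: "\<bar>w\<bar> = a + b" "in_band y a" "b \<bottom>\<^sub>l y"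
    using band_decomposition_nonneg[of "\<bar>w\<bar>" y] y by auto
  \<comment> \<open>\<open>w\<close> is written as a difference of two nonnegative elements; both
    kinds of component are closed under subtraction.\<close>
  have "0 \<le> \<bar>w\<bar> - w"
    by (simp add: abs_ge_self)
  then obtain a' b' where ab': "\<bar>w\<bar> - w = a' + b'" "in_band y a'" "b' \<bottom>\<^sub>l y"
    using band_decomposition_nonneg[of "\<bar>w\<bar> - w" y] y by auto
  have "w = \<bar>w\<bar> - (\<bar>w\<bar> - w)" by simp
  also have "\<dots> = (a + b) - (a' + b')"
    by (simp only: ab(1) ab'(1)[unfolded ab(1)])
  also have "\<dots> = (a - a') + (b - b')"
    by simp
  finally show thesis
    using that ab ab' in_band_diff lattice_disjoint_diff_left by blast
qed

text \<open>As \<open>a = (a + b) - b\<close> is disjoint from \<open>y\<close>, it is disjoint from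
  itself. This stands in for \<open>P (a + b) = 0\<close>, since \<open>P\<close> is never built as
  an operator.\<close>

lemma in_band_eq_zero_if_add_disjoint:
  fixes a b y :: "'a::banach_lattice"
  assumes "in_band y a" "b \<bottom>\<^sub>l y" "(a + b) \<bottom>\<^sub>l y"
  shows "a = 0"
proof -
  have "a \<bottom>\<^sub>l y"
    using lattice_disjoint_diff_left[OF assms(3,2)] by simp
  with assms(1) have "a \<bottom>\<^sub>l a"
    by (rule in_band_disjoint)
  then show ?thesis by (simp add: lattice_disjoint_def)
qed

text \<open>The test element is \<open>\<bar>b\<bar>\<close>: disjointness from \<open>a\<close>
  puts it below \<open>\<bar>T x\<bar>\<close>, so the infimum is \<open>\<bar>b\<bar>\<close>
  itself.\<close>

lemma band_preserving_norm_le: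
  fixes T :: "'a::banach_lattice \<Rightarrow> 'a"
  assumes T: "band_preserving \<delta> T" and "a \<bottom>\<^sub>l b" "b \<bottom>\<^sub>l x" "T x = a + b"
  shows "norm b \<le> \<delta> * norm x"
proof -
  have "inf \<bar>T x\<bar> \<bar>b\<bar> = \<bar>b\<bar>"
    using lattice_disjoint_abs_le_abs_add[of a b] assms by (simp add: inf_absorb2)
  moreover have "norm \<bar>b\<bar> = norm b"
    by (intro order.antisym norm_lattice_mono) auto
  ultimately have "norm b \<in> {norm (inf \<bar>T x\<bar> y) | y. 0 \<le> y \<and> y \<bottom>\<^sub>l x}"
    using assms by (auto simp: lattice_disjoint_abs_left intro!: exI[of _ "\<bar>b\<bar>"])
  then have "norm b \<le> Sup {norm (inf \<bar>T x\<bar> y) | y. 0 \<le> y \<and> y \<bottom>\<^sub>l x}"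
    by (intro cSup_upper band_preserving_set)
  also have "\<dots> \<le> \<delta> * norm x"
    using T by (simp add: band_preserving_def)
  finally show ?thesis .
qed

lemma band_preserving_inverse:
  fixes S T :: "'a::sigma_dedekind_complete_banach_lattice \<Rightarrow>\<^sub>L 'a"
  assumes \<epsilon>: "0 \<le> \<epsilon>" and T: "band_preserving \<epsilon> (blinfun_apply T)"
    and ST: "\<And>x. S (T x) = x" and TS: "\<And>x. T (S x) = x"
  shows "band_preserving (2 * (norm S)\<^sup>2 * \<epsilon>) (blinfun_apply S)"
proof -
  have "norm (inf \<bar>S x\<bar> y) \<le> 2 * (norm S)\<^sup>2 * \<epsilon> * norm x" if y: "0 \<le> y" and yx: "y \<bottom>\<^sub>l x" for x y
  proof -
    define z where "z = S x"
    \<comment> \<open>In terms of \<open>P\<close>: \<open>z1 = P z\<close>,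
      \<open>z2 = z - P z\<close>, and \<open>a1\<close>, \<open>a2\<close> are the band components
      of \<open>T z1\<close>, \<open>T z2\<close>.\<close>
    obtain z1 z2 where z: "z = z1 + z2" and z1: "in_band y z1" and z2: "z2 \<bottom>\<^sub>l y"
      using band_decomposition[OF y] by blast
    obtain a1 b1 where T1: "T z1 = a1 + b1" and a1: "in_band y a1" and b1: "b1 \<bottom>\<^sub>l y"
      using band_decomposition[OF y] by blast
    obtain a2 b2 where T2: "T z2 = a2 + b2" and a2: "in_band y a2" and b2: "b2 \<bottom>\<^sub>l y"
      using band_decomposition[OF y] by blast
    have "z1 \<bottom>\<^sub>l z2"
      using z1 z2 by (rule in_band_disjoint)
    then have nz: "norm z1 \<le> norm z" "norm z2 \<le> norm z"
      using lattice_disjoint_abs_le_abs_add[of z1 z2] lattice_disjoint_abs_le_abs_add[of z2 z1]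
      by (simp_all add: z norm_lattice_mono lattice_disjoint_sym add.commute)
    have "x = T z1 + T z2"
      using TS[of x] by (simp add: z_def[symmetric] z blinfun.add_right)
    then have "x = (a1 + a2) + (b1 + b2)"
      by (simp add: T1 T2)
    \<comment> \<open>The hypothesis on \<open>T\<close> gives no direct bound on \<open>a1\<close>,
      which lies in the same band as \<open>z1\<close>. It is bounded through \<open>a2\<close>,
      which is disjoint from \<open>z2\<close>.\<close>
    then have "a1 + a2 = 0"
      using in_band_eq_zero_if_add_disjoint[OF in_band_add[OF a1 a2] lattice_disjoint_add_left[OF b1 b2]]
        yx by (simp add: lattice_disjoint_sym)
    then have "norm a1 = norm a2"
      by (simp add: eq_neg_iff_add_eq_0[symmetric])
    also have "\<dots> \<le> \<epsilon> * norm z2"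
      using band_preserving_norm_le[OF T, of b2 a2 z2] in_band_disjoint[OF a2 b2]
        in_band_disjoint[OF a2 z2] T2
      by (simp add: lattice_disjoint_sym add.commute)
    also have "\<dots> \<le> \<epsilon> * norm z"
      using nz \<epsilon> by (intro mult_left_mono)
    finally have na: "norm a1 \<le> \<epsilon> * norm z" .
    have "norm b1 \<le> \<epsilon> * norm z1"
      using band_preserving_norm_le[OF T, of a1 b1 z1] in_band_disjoint[OF a1 b1]
        in_band_disjoint[OF z1 b1] T1
      by (simp add: lattice_disjoint_sym)
    also have "\<dots> \<le> \<epsilon> * norm z"
      using nz \<epsilon> by (intro mult_left_mono)
    finally have "norm (T z1) \<le> 2 * \<epsilon> * norm z"
      using na norm_triangle_ineq[of a1 b1] T1 by simp
    have "\<bar>inf \<bar>z\<bar> y\<bar> = inf \<bar>z\<bar> y"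
      using y by (simp add: abs_of_nonneg)
    also have "\<dots> \<le> inf (\<bar>z1\<bar> + \<bar>z2\<bar>) y"
      unfolding z by (intro inf_mono abs_triangle_ineq order_refl)
    also have "\<dots> \<le> inf \<bar>z1\<bar> y + inf \<bar>z2\<bar> y"
      using y by (intro inf_add_le_add_inf) auto
    also have "\<dots> \<le> \<bar>z1\<bar>"
      using z2 y by (simp add: lattice_disjoint_def abs_of_nonneg)
    finally have "norm (inf \<bar>z\<bar> y) \<le> norm z1"
      by (rule norm_lattice_mono)
    also have "\<dots> = norm (S (T z1))"
      by (simp add: ST)
    also have "\<dots> \<le> norm S * norm (T z1)"
      by (rule norm_blinfun)
    also have "\<dots> \<le> norm S * (2 * \<epsilon> * norm z)"
      using \<open>norm (T z1) \<le> _\<close> by (intro mult_left_mono) auto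
    \<comment> \<open>The second factor \<open>norm S\<close> comes from \<open>z = S x\<close>, the
      first from \<open>z1 = S (T z1)\<close>.\<close>
    also have "\<dots> \<le> norm S * (2 * \<epsilon> * (norm S * norm x))"
      unfolding z_def using \<epsilon> by (intro mult_left_mono norm_blinfun) auto
    finally show ?thesis
      by (simp add: z_def power2_eq_square ac_simps)
  qed
  then have "Sup {norm (inf \<bar>S x\<bar> y) | y. 0 \<le> y \<and> y \<bottom>\<^sub>l x} \<le> 2 * (norm S)\<^sup>2 * \<epsilon> * norm x" for x
    by (intro cSup_least band_preserving_set) auto
  then show ?thesis
    by (simp add: band_preserving_def bounded_linear.linear blinfun.bounded_linear_right)
qed

theorem corollary2p5:
  fixes T :: "'a::sigma_dedekind_complete_banach_lattice \<Rightarrow>\<^sub>L 'a"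
    and \<epsilon> :: real
  assumes "\<epsilon> \<ge> 0"
    and "invertible_blinfun T"
    and "band_preserving \<epsilon> (blinfun_apply T)"
  shows "band_preserving (2 * (norm (inv_blinfun T))\<^sup>2 * \<epsilon>) (blinfun_apply (inv_blinfun T))"
proof -
  obtain S where S: "S o\<^sub>L T = id_blinfun" "T o\<^sub>L S = id_blinfun"
    using assms(2) by (auto simp: invertible_blinfun_def)
  have inv: "S (T x) = x" "T (S x) = x" for x
    using arg_cong[OF S(1), of "\<lambda>U. blinfun_apply U x"]
      arg_cong[OF S(2), of "\<lambda>U. blinfun_apply U x"] by simp_all
  show ?thesis
    unfolding inv_blinfun_eqI[OF S] by (rule band_preserving_inverse[OF assms(1,3) inv])
qed

end
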